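(* Let $X$ be a set. Then: (1) The unitary solutions on $X$ are precisely those isomorphic to a solution of the form $$R_\omega:(A\times B)^2\to(A\times B)^2,\qquad R_\omega\bigl((a_1,b_1),(a_2,b_2)\bigr)=\bigl((a_1,b_2),(a_2,\omega(b_1))\bigr)$$ for some decomposition $X\cong A\times B$ with $A,B$ non-empty sets and some involution $\omega:B\to B$ (i.e. $\omega^2=\mathrm{Id}_B$). (2) If $X$ is a finite set with $|X|=n$, then the number of isomorphism classes of unitary solutions on $X$ is equal to $$\sum_{d\mid n}\Bigl(1+\Bigl\lfloor\frac d2\Bigr\rfloor\Bigr)=\tau(n)+\sum_{d\mid n}\Bigl\lfloor\frac d2\Bigr\rfloor,$$ where $\tau(n)$ is the number of divisors of $n$.
   Context: All sets are non-empty. For a set $X$ let $\tau_X(x,y)=(y,x)$ be the flip map on $X\times X$. For a map $R:X\times X\to X\times X$ put, as maps $X^3\to X^3$, $R^{12}=R\times \mathrm{Id}_X$, $R^{23}=\mathrm{Id}_X\times R$, $R^{13}=(\mathrm{Id}_X\times\tau_X)\circ R^{12}\circ(\mathrm{Id}_X\times\tau_X)$. $R$ is called a solution on $X$ (of the set-theoretic Frobenius-Separability equation) if $R^{12}R^{23}=R^{23}R^{13}=R^{13}R^{12}$. A solution $R$ on $X$ is unitary if $R^{21}R=\mathrm{Id}_{X\times X}$, where $R^{21}=\tau_XR\tau_X$. An isomorphism of solutions $(X,R)\to(X',R')$ is a bijection $\sigma:X\to X'$ with $(\sigma\times\sigma)\circ R=R'\circ(\sigma\times\sigma)$. *)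

theory Defs
  imports "HOL-Library.FuncSet"
begin

text \<open>
  Sets are carriers \<^term>\<open>X :: 'a set\<close>. A map \<open>R : X \<times> X \<rightarrow> X \<times> X\<close> is an extensional function,
  i.e. an element of \<^term>\<open>X \<times> X \<rightarrow>\<^sub>E X \<times> X\<close>, so that equality of maps is equality in HOL.
  The flip map is \<^term>\<open>prod.swap\<close>, and the cube of \<open>X\<close> is \<^term>\<open>X \<times> X \<times> X\<close>, nested to the right.
\<close>

definition R12 :: "('a \<times> 'a \<Rightarrow> 'a \<times> 'a) \<Rightarrow> 'a \<times> 'a \<times> 'a \<Rightarrow> 'a \<times> 'a \<times> 'a" where
  "R12 R = (\<lambda>(x, y, z). (fst (R (x, y)), snd (R (x, y)), z))"

definition R23 :: "('a \<times> 'a \<Rightarrow> 'a \<times> 'a) \<Rightarrow> 'a \<times> 'a \<times> 'a \<Rightarrow> 'a \<times> 'a \<times> 'a" where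
  "R23 R = map_prod id R"

definition R13 :: "('a \<times> 'a \<Rightarrow> 'a \<times> 'a) \<Rightarrow> 'a \<times> 'a \<times> 'a \<Rightarrow> 'a \<times> 'a \<times> 'a" where
  "R13 R = map_prod id prod.swap \<circ> R12 R \<circ> map_prod id prod.swap"

definition R21 :: "('a \<times> 'a \<Rightarrow> 'a \<times> 'a) \<Rightarrow> 'a \<times> 'a \<Rightarrow> 'a \<times> 'a" where
  "R21 R = prod.swap \<circ> R \<circ> prod.swap"

definition fs_solution :: "'a set \<Rightarrow> ('a \<times> 'a \<Rightarrow> 'a \<times> 'a) \<Rightarrow> bool" where
  "fs_solution X R \<longleftrightarrow>
     R \<in> X \<times> X \<rightarrow>\<^sub>E X \<times> X \<and>
     (\<forall>t \<in> X \<times> X \<times> X. (R12 R \<circ> R23 R) t = (R23 R \<circ> R13 R) t \<and>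
                      (R23 R \<circ> R13 R) t = (R13 R \<circ> R12 R) t)"

definition unitary_fs_solution :: "'a set \<Rightarrow> ('a \<times> 'a \<Rightarrow> 'a \<times> 'a) \<Rightarrow> bool" where
  "unitary_fs_solution X R \<longleftrightarrow>
     fs_solution X R \<and> (\<forall>p \<in> X \<times> X. (R21 R \<circ> R) p = p)"

text \<open>
  Isomorphism is defined for arbitrary maps on \<open>X \<times> X\<close> and \<open>X' \<times> X'\<close>, without requiring them to be
  solutions; only their values on the carriers matter.
\<close>

definition fs_isomorphic ::
  "'a set \<Rightarrow> ('a \<times> 'a \<Rightarrow> 'a \<times> 'a) \<Rightarrow> 'b set \<Rightarrow> ('b \<times> 'b \<Rightarrow> 'b \<times> 'b) \<Rightarrow> bool" where
  "fs_isomorphic X R X' R' \<longleftrightarrow>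
     (\<exists>\<sigma>. bij_betw \<sigma> X X' \<and>
          (\<forall>p \<in> X \<times> X. (map_prod \<sigma> \<sigma> \<circ> R) p = (R' \<circ> map_prod \<sigma> \<sigma>) p))"

definition unitary_fs_iso_rel ::
  "'a set \<Rightarrow> (('a \<times> 'a \<Rightarrow> 'a \<times> 'a) \<times> ('a \<times> 'a \<Rightarrow> 'a \<times> 'a)) set" where
  "unitary_fs_iso_rel X =
     {(R, S). unitary_fs_solution X R \<and> unitary_fs_solution X S \<and> fs_isomorphic X R X S}"

definition unitary_fs_iso_classes :: "'a set \<Rightarrow> ('a \<times> 'a \<Rightarrow> 'a \<times> 'a) set set" where
  "unitary_fs_iso_classes X = {R. unitary_fs_solution X R} // unitary_fs_iso_rel X"

definition involution_on :: "'b set \<Rightarrow> ('b \<Rightarrow> 'b) \<Rightarrow> bool" where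
  "involution_on B \<omega> \<longleftrightarrow> \<omega> \<in> B \<rightarrow> B \<and> (\<forall>b\<in>B. \<omega> (\<omega> b) = b)"

definition R_omega :: "'a set \<Rightarrow> 'b set \<Rightarrow> ('b \<Rightarrow> 'b) \<Rightarrow>
    ('a \<times> 'b) \<times> ('a \<times> 'b) \<Rightarrow> ('a \<times> 'b) \<times> ('a \<times> 'b)" where
  "R_omega A B \<omega> =
     restrict (\<lambda>((a1, b1), (a2, b2)). ((a1, b2), (a2, \<omega> b1))) ((A \<times> B) \<times> (A \<times> B))"

end

theory Submission
  imports Defs
begin

text \<open>
  Write \<open>R (x, y) = (f x y, g x y)\<close>. The three composites in the Frobenius-Separability equation,
  compared componentwise, say that \<open>f\<close> satisfies \<open>f x (f y z) = f (f x y) z = f x z\<close> and that \<open>g\<close>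
  interacts with \<open>f\<close> in a similarly rigid way. Unitarity makes every element a value of \<open>f\<close>, which
  forces \<open>f x x = x\<close>. Thus \<open>f\<close> is a rectangular band, that is, up to a bijection of \<open>X\<close> with
  some \<open>A \<times> B\<close> it is \<open>f (a1, b1) (a2, b2) = (a1, b2)\<close>. In these coordinates the equations for \<open>g\<close>
  leave only \<open>g (a1, b1) (a2, b2) = (a2, \<omega> b1)\<close>, and unitarity is \<open>\<omega> (\<omega> b) = b\<close>. The coordinates
  are obtained inside \<open>X\<close> itself from a base point \<open>e\<close>: the factors are the sets of all \<open>f x e\<close> and
  of all \<open>f e x\<close> (lemma \<open>unitary_fs_solution_decomposition\<close>). The converse is a computation,
  followed by transport along an isomorphism.

  For finite \<open>X\<close> with \<open>n\<close> elements, an involution on a set \<open>B\<close> with \<open>d\<close> elements is determined up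
  to conjugacy by its number \<open>k \<le> d div 2\<close> of two-element orbits (lemma
  \<open>involution_on_normal_form\<close>), so every solution is isomorphic to a model indexed by a divisor \<open>d\<close>
  of \<open>n\<close> and such a \<open>k\<close>. Different indices give non-isomorphic models, because two numbers are
  preserved by isomorphisms (lemma \<open>R_omega_invariants\<close>): for any \<open>x\<close>, the number of \<open>y\<close> with
  \<open>f x y = x\<close>, which is \<open>n div d\<close>, and the number of \<open>x\<close> with \<open>g x x = x\<close>, which is
  \<open>(n div d) * (d - 2 * k)\<close>. Counting the indices gives the formula.
\<close>

section \<open>Unitary solutions as pairs of binary operations\<close>

lemma unitary_fs_solution_iff:
  assumes R_eq: "\<And>x y. R (x, y) = (f x y, g x y)"
  shows "unitary_fs_solution X R \<longleftrightarrow>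
    R \<in> X \<times> X \<rightarrow>\<^sub>E X \<times> X \<and>
    (\<forall>x\<in>X. \<forall>y\<in>X. \<forall>z\<in>X.
       f x (f y z) = f x z \<and> f (f x y) z = f x z \<and>
       g x (f y z) = g x y \<and> f y (g x z) = g x y \<and>
       g y (g x z) = g y z \<and> g (f x y) z = g y z) \<and>
    (\<forall>x\<in>X. \<forall>y\<in>X. g (g x y) (f x y) = x \<and> f (g x y) (f x y) = y)"
proof -
  have "(R12 R \<circ> R23 R) (x, y, z) = (R23 R \<circ> R13 R) (x, y, z) \<and>
      (R23 R \<circ> R13 R) (x, y, z) = (R13 R \<circ> R12 R) (x, y, z) \<longleftrightarrow>
      f x (f y z) = f x z \<and> f (f x y) z = f x z \<and>
      g x (f y z) = g x y \<and> f y (g x z) = g x y \<and>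
      g y (g x z) = g y z \<and> g (f x y) z = g y z" for x y z
    by (auto simp: R12_def R23_def R13_def R_eq)
  moreover have "(R21 R \<circ> R) (x, y) = (x, y) \<longleftrightarrow>
      g (g x y) (f x y) = x \<and> f (g x y) (f x y) = y" for x y
    by (auto simp: R21_def R_eq)
  ultimately show ?thesis
    by (simp only: unitary_fs_solution_def fs_solution_def split_paired_Ball_Sigma conj_assoc)
qed

lemma R_omega_apply:
  "\<lbrakk>a1 \<in> A; b1 \<in> B; a2 \<in> A; b2 \<in> B\<rbrakk> \<Longrightarrow>
    R_omega A B \<omega> ((a1, b1), (a2, b2)) = ((a1, b2), (a2, \<omega> b1))"
  by (simp add: R_omega_def)

text \<open>
  With \<open>f\<close> and \<open>g\<close> the components of \<open>R_omega A B \<omega>\<close>, the equations of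
  \<open>unitary_fs_solution_iff\<close> become identities between coordinates.
\<close>

lemma unitary_R_omega:
  assumes "involution_on B \<omega>"
  shows "unitary_fs_solution (A \<times> B) (R_omega A B \<omega>)"
proof -
  have \<omega>: "\<omega> b \<in> B" "\<omega> (\<omega> b) = b" if "b \<in> B" for b
    using assms that by (auto simp: involution_on_def)
  have "R_omega A B \<omega> \<in> (A \<times> B) \<times> (A \<times> B) \<rightarrow>\<^sub>E (A \<times> B) \<times> (A \<times> B)"
    unfolding R_omega_def by (rule restrict_PiE_iff[THEN iffD2]) (auto simp: \<omega>)
  then show ?thesis
    by (auto simp: unitary_fs_solution_iff[of "R_omega A B \<omega>"
          "\<lambda>x y. fst (R_omega A B \<omega> (x, y))" "\<lambda>x y. snd (R_omega A B \<omega> (x, y))"]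
          R_omega_apply \<omega>)
qed

section \<open>Isomorphisms\<close>

lemma fs_isomorphic_trans:
  assumes "fs_isomorphic X R Y S" "fs_isomorphic Y S Z T"
  shows "fs_isomorphic X R Z T"
proof -
  obtain \<sigma> where \<sigma>: "bij_betw \<sigma> X Y"
      "\<And>p. p \<in> X \<times> X \<Longrightarrow> map_prod \<sigma> \<sigma> (R p) = S (map_prod \<sigma> \<sigma> p)"
    using assms(1) by (auto simp: fs_isomorphic_def)
  obtain \<tau> where \<tau>: "bij_betw \<tau> Y Z"
      "\<And>p. p \<in> Y \<times> Y \<Longrightarrow> map_prod \<tau> \<tau> (S p) = T (map_prod \<tau> \<tau> p)"
    using assms(2) by (auto simp: fs_isomorphic_def)
  have "(map_prod (\<tau> \<circ> \<sigma>) (\<tau> \<circ> \<sigma>) \<circ> R) p = (T \<circ> map_prod (\<tau> \<circ> \<sigma>) (\<tau> \<circ> \<sigma>)) p"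
    if p: "p \<in> X \<times> X" for p
  proof -
    have "map_prod \<sigma> \<sigma> p \<in> Y \<times> Y"
      using p bij_betw_apply[OF \<sigma>(1)] by auto
    then show ?thesis
      using \<sigma>(2)[OF p] \<tau>(2) by (metis comp_apply map_prod.comp)
  qed
  with bij_betw_trans[OF \<sigma>(1) \<tau>(1)] show ?thesis
    unfolding fs_isomorphic_def by blast
qed

text \<open>
  The values of \<open>R\<close> must stay in \<open>X \<times> X\<close>: a bijection on \<open>X\<close> can only be cancelled there.
\<close>

lemma fs_isomorphic_sym:
  assumes R: "R \<in> X \<times> X \<rightarrow> X \<times> X" and iso: "fs_isomorphic X R Y S"
  shows "fs_isomorphic Y S X R"
proof -
  obtain \<sigma> where \<sigma>: "bij_betw \<sigma> X Y"
      "\<And>p. p \<in> X \<times> X \<Longrightarrow> map_prod \<sigma> \<sigma> (R p) = S (map_prod \<sigma> \<sigma> p)"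
    using iso by (auto simp: fs_isomorphic_def)
  define \<tau> where "\<tau> = inv_into X \<sigma>"
  have \<tau>: "\<tau> y \<in> X" "\<sigma> (\<tau> y) = y" if "y \<in> Y" for y
    using that \<sigma>(1) unfolding \<tau>_def bij_betw_def
    by (auto simp: inv_into_into f_inv_into_f)
  have \<tau>\<sigma>: "map_prod \<tau> \<tau> (map_prod \<sigma> \<sigma> p) = p" if "p \<in> X \<times> X" for p
    using that \<sigma>(1) by (auto simp: \<tau>_def bij_betw_inv_into_left)
  have "map_prod \<tau> \<tau> (S q) = R (map_prod \<tau> \<tau> q)" if q: "q \<in> Y \<times> Y" for q
  proof -
    have p: "map_prod \<tau> \<tau> q \<in> X \<times> X" and "map_prod \<sigma> \<sigma> (map_prod \<tau> \<tau> q) = q"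
      using q \<tau> by auto
    then have "S q = map_prod \<sigma> \<sigma> (R (map_prod \<tau> \<tau> q))"
      using \<sigma>(2)[OF p] by simp
    moreover have "R (map_prod \<tau> \<tau> q) \<in> X \<times> X"
      using R p by (rule funcset_mem)
    ultimately show ?thesis
      using \<tau>\<sigma> by metis
  qed
  moreover have "bij_betw \<tau> Y X"
    unfolding \<tau>_def using \<sigma>(1) by (rule bij_betw_inv_into)
  ultimately show ?thesis
    unfolding fs_isomorphic_def by auto
qed

lemma unitary_fs_isomorphic_sym:
  "\<lbrakk>unitary_fs_solution X R; fs_isomorphic X R Y S\<rbrakk> \<Longrightarrow> fs_isomorphic Y S X R"
  by (rule fs_isomorphic_sym)
    (auto simp: unitary_fs_solution_def fs_solution_def PiE_iff)

text \<open>
  Being a unitary solution is expressed by identities in the two operations, and an isomorphism is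
  an isomorphism of algebras with these operations.
\<close>

lemma unitary_fs_solution_transport:
  assumes R: "R \<in> X \<times> X \<rightarrow>\<^sub>E X \<times> X"
    and iso: "fs_isomorphic X R Y S" and S: "unitary_fs_solution Y S"
  shows "unitary_fs_solution X R"
proof -
  define f where "f = (\<lambda>x y. fst (R (x, y)))"
  define g where "g = (\<lambda>x y. snd (R (x, y)))"
  define f' where "f' = (\<lambda>x y. fst (S (x, y)))"
  define g' where "g' = (\<lambda>x y. snd (S (x, y)))"
  have R_eq: "\<And>x y. R (x, y) = (f x y, g x y)" and S_eq: "\<And>x y. S (x, y) = (f' x y, g' x y)"
    by (auto simp: f_def g_def f'_def g'_def)
  obtain \<sigma> where \<sigma>: "bij_betw \<sigma> X Y"
      "\<And>p. p \<in> X \<times> X \<Longrightarrow> map_prod \<sigma> \<sigma> (R p) = S (map_prod \<sigma> \<sigma> p)"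
    using iso by (auto simp: fs_isomorphic_def)
  have fg: "f x y \<in> X" "g x y \<in> X" if "x \<in> X" "y \<in> X" for x y
    using R that by (auto simp: PiE_iff R_eq)
  have hom: "\<sigma> (f x y) = f' (\<sigma> x) (\<sigma> y)" "\<sigma> (g x y) = g' (\<sigma> x) (\<sigma> y)"
    if "x \<in> X" "y \<in> X" for x y
    using \<sigma>(2)[of "(x, y)"] that by (auto simp: R_eq S_eq)
  have Y: "\<sigma> x \<in> Y" if "x \<in> X" for x
    using \<sigma>(1) that by (rule bij_betw_apply)
  have cancel: "x = y \<longleftrightarrow> \<sigma> x = \<sigma> y" if "x \<in> X" "y \<in> X" for x y
    using \<sigma>(1) that by (auto simp: bij_betw_def inj_on_def)
  show ?thesis
    using S R
    by (simp add: unitary_fs_solution_iff[of R f g, OF R_eq] unitary_fs_solution_iff[of S f' g', OF S_eq]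
        cancel fg hom Y)
qed

section \<open>The decomposition of a unitary solution\<close>

text \<open>
  The coordinates of \<open>x\<close> are \<open>f x e\<close> and \<open>f e x\<close> for a base point \<open>e\<close>, and the element with
  coordinates \<open>a\<close>, \<open>b\<close> is \<open>f a b\<close>: indeed \<open>f (f x e) (f e x) = f x x = x\<close>. The first coordinate of
  \<open>g x y\<close> is that of \<open>y\<close> since \<open>g x y = f y (g x z)\<close>. Its second coordinate is \<open>f e (g x y) = g x e\<close>,
  and \<open>g x e = g (f e x) e\<close> depends only on the second coordinate of \<open>x\<close>. This forces
  \<open>\<omega> b = g b e\<close>.
\<close>

lemma unitary_fs_solution_decomposition:
  fixes X :: "'a set"
  assumes "X \<noteq> {}" and R: "unitary_fs_solution X R"
  obtains A B :: "'a set" and \<omega>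
  where "A \<noteq> {}" "B \<noteq> {}" "involution_on B \<omega>"
    "fs_isomorphic X R (A \<times> B) (R_omega A B \<omega>)"
proof -
  define f where "f = (\<lambda>x y. fst (R (x, y)))"
  define g where "g = (\<lambda>x y. snd (R (x, y)))"
  have R_eq: "\<And>x y. R (x, y) = (f x y, g x y)"
    by (auto simp: f_def g_def)
  note ax = R[unfolded unitary_fs_solution_iff[of R f g, OF R_eq]]
  have cl: "f x y \<in> X" "g x y \<in> X" if "x \<in> X" "y \<in> X" for x y
    using ax that by (auto simp: PiE_iff R_eq)
  have f1: "f x (f y z) = f x z" and f2: "f (f x y) z = f x z"
    and g1: "g x (f y z) = g x y" and g2: "f y (g x z) = g x y"
    and g3: "g (f x y) z = g y z"
    if "x \<in> X" "y \<in> X" "z \<in> X" for x y z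
    using ax that by blast+
  have u1: "g (g x y) (f x y) = x" and u2: "f (g x y) (f x y) = y" if "x \<in> X" "y \<in> X" for x y
    using ax that by blast+
  \<comment> \<open>With \<open>u = g x x\<close>, unitarity gives \<open>x = f u (f x x) = f u x\<close>, so
      \<open>f x x = f (f u x) x = f u x = x\<close>.\<close>
  have idem: "f x x = x" if "x \<in> X" for x
    using u2[of x x] f1[of "g x x" x x] f2[of "g x x" x x] that cl by metis
  obtain e where e: "e \<in> X"
    using \<open>X \<noteq> {}\<close> by blast
  define A where "A = (\<lambda>x. f x e) ` X"
  define B where "B = f e ` X"
  define \<sigma> where "\<sigma> = (\<lambda>x. (f x e, f e x))"
  have A: "a \<in> X" "f a e = a" if "a \<in> A" for a
    using that e by (auto simp: A_def cl f2)
  have B: "b \<in> X" "f e b = b" if "b \<in> B" for b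
    using that e by (auto simp: B_def cl f1)
  have inv: "involution_on B (\<lambda>b. g b e)"
    unfolding involution_on_def
  proof (intro conjI ballI funcsetI)
    fix b assume b: "b \<in> B"
    then have bX: "b \<in> X" using B by blast
    have "g b e = f e (g b e)" using g2[of b e e] e bX by simp
    then show "g b e \<in> B" using cl[OF bX e] by (auto simp: B_def)
    show "g (g b e) e = b"
    proof -
      have "f b e \<in> X" "g b e \<in> X" using cl bX e by auto
      \<comment> \<open>Unitarity recovers \<open>b\<close> as \<open>g (g b e) (f b e)\<close>. Replacing the second argument \<open>f b e\<close>
          of \<open>g\<close> by \<open>e\<close> changes only the first coordinate, which \<open>f e\<close> resets to that of \<open>e\<close>.\<close>
      then have "g (g b e) e = f e (g (g b e) (f b e))"
        using g2[of "g b e" e "f b e"] e by simp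
      also have "\<dots> = f e b" using u1[OF bX e] by simp
      finally show ?thesis using B b by simp
    qed
  qed
  have bij: "bij_betw \<sigma> X (A \<times> B)"
  proof (rule bij_betw_byWitness[where f' = "\<lambda>(a, b). f a b"])
    show "\<forall>x\<in>X. (\<lambda>(a, b). f a b) (\<sigma> x) = x"
      using e by (auto simp: \<sigma>_def f1 f2 cl idem)
    show "\<forall>p\<in>A \<times> B. \<sigma> ((\<lambda>(a, b). f a b) p) = p"
      using A B e by (auto simp: \<sigma>_def) (metis f1 f2)+
    show "\<sigma> ` X \<subseteq> A \<times> B"
      by (auto simp: \<sigma>_def A_def B_def)
    show "(\<lambda>(a, b). f a b) ` (A \<times> B) \<subseteq> X"
      using A B cl by auto
  qed
  have hom: "(map_prod \<sigma> \<sigma> \<circ> R) p = (R_omega A B (\<lambda>b. g b e) \<circ> map_prod \<sigma> \<sigma>) p"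
    if "p \<in> X \<times> X" for p
  proof -
    from that obtain x y where p: "p = (x, y)" "x \<in> X" "y \<in> X"
      by auto
    have "f x e \<in> A" "f e x \<in> B" "f y e \<in> A" "f e y \<in> B"
      using p by (auto simp: A_def B_def)
    then have "R_omega A B (\<lambda>b. g b e) (\<sigma> x, \<sigma> y) = ((f x e, f e y), (f y e, g (f e x) e))"
      by (simp add: \<sigma>_def R_omega_apply)
    moreover have "f (g x y) e = f y e"
      using g2[of x y y] f2[of y "g x y" e] p e cl by metis
    moreover have "f e (g x y) = g (f e x) e"
      using g2[of x e y] g3[of e x e] p e by simp
    ultimately show ?thesis
      using p e by (simp add: R_eq) (simp add: \<sigma>_def f1 f2)
  qed
  show ?thesis
  proof (rule that[OF _ _ inv])
    show "A \<noteq> {}" "B \<noteq> {}" using e by (auto simp: A_def B_def)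
    show "fs_isomorphic X R (A \<times> B) (R_omega A B (\<lambda>b. g b e))"
      unfolding fs_isomorphic_def using bij hom by blast
  qed
qed

section \<open>Normal forms of involutions on finite sets\<close>

text \<open>
  The product of the transpositions of \<open>2 * i\<close> and \<open>2 * i + 1\<close> for \<open>i < k\<close>.
\<close>

definition std_involution :: "nat \<Rightarrow> nat \<Rightarrow> nat" where
  "std_involution k i = (if i < 2 * k then if even i then i + 1 else i - 1 else i)"

lemma std_involution_Suc:
  "std_involution (Suc k) 0 = 1" "std_involution (Suc k) 1 = 0"
  "std_involution (Suc k) (i + 2) = std_involution k i + 2"
  by (auto simp: std_involution_def elim: oddE)

lemma involution_on_std:
  assumes "2 * k \<le> d"
  shows "involution_on {..<d} (std_involution k)"
  using assms unfolding involution_on_def std_involution_def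
  by (auto elim!: evenE oddE)

lemma card_fixed_points_std_involution:
  "card {i \<in> {..<d}. std_involution k i = i} = d - 2 * k"
proof -
  have "{i \<in> {..<d}. std_involution k i = i} = {2 * k..<d}"
    by (auto simp: std_involution_def split: if_splits elim: oddE)
  then show ?thesis by simp
qed

text \<open>
  Induction on the size of \<open>B\<close>: a two-element orbit is sent to the initial pair \<open>0, 1\<close>, and the
  numbering of the remaining elements is shifted by two, which is compatible with the standard
  involutions by \<open>std_involution_Suc\<close>. Once all points are fixed, any numbering will do.
\<close>

lemma involution_on_normal_form:
  assumes "finite B" "involution_on B \<omega>"
  shows "\<exists>h k. bij_betw h B {..<card B} \<and> 2 * k \<le> card B \<and>
    (\<forall>b\<in>B. h (\<omega> b) = std_involution k (h b))"
  using assms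
proof (induction "card B" arbitrary: B rule: less_induct)
  case less
  have \<omega>: "\<omega> b \<in> B" "\<omega> (\<omega> b) = b" if "b \<in> B" for b
    using less.prems that by (auto simp: involution_on_def)
  show ?case
  proof (cases "\<exists>b\<in>B. \<omega> b \<noteq> b")
    case False
    obtain h where "bij_betw h B {..<card B}"
      using ex_bij_betw_finite_nat[OF less.prems(1)] by (auto simp: atLeast0LessThan)
    with False show ?thesis
      by (intro exI[of _ h] exI[of _ 0]) (auto simp: std_involution_def)
  next
    case True
    then obtain b where b: "b \<in> B" "\<omega> b \<noteq> b" by blast
    define C where "C = B - {b, \<omega> b}"
    have B: "B = insert b (insert (\<omega> b) C)" "b \<notin> C" "\<omega> b \<notin> C" "finite C"
      using b \<omega> less.prems(1) by (auto simp: C_def)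
    have card: "card B = card C + 2"
      using b B by simp
    have "\<omega> x \<in> C" if "x \<in> C" for x
      using that b \<omega> unfolding C_def by (metis DiffD1 DiffD2 DiffI insert_iff singletonD)
    then have "involution_on C \<omega>"
      using \<omega> by (auto simp: involution_on_def C_def)
    then obtain h k where h: "bij_betw h C {..<card C}" "2 * k \<le> card C"
        "\<And>x. x \<in> C \<Longrightarrow> h (\<omega> x) = std_involution k (h x)"
      using less.hyps[of C] card B(4) by auto
    define h' where "h' = (\<lambda>x. if x = b then 0 else if x = \<omega> b then 1 else h x + 2)"
    have h'_C: "h' x = h x + 2" if "x \<in> C" for x
      using that B by (auto simp: h'_def)
    have h'_b: "h' b = 0" "h' (\<omega> b) = 1"
      using b by (auto simp: h'_def)
    have "h' ` C = {2..<card B}"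
    proof -
      have "h' ` C = (\<lambda>i. i + 2) ` h ` C"
        using h'_C by (auto simp: image_image cong: image_cong_simp)
      also have "\<dots> = (\<lambda>i. i + 2) ` {0..<card C}"
        using h(1) by (simp add: bij_betw_def atLeast0LessThan)
      finally show ?thesis by (simp only: card image_add_atLeastLessThan' add_0)
    qed
    then have "h' ` B = {..<card B}"
      using card h'_b by (subst B(1)) (auto simp: image_insert)
    then have "bij_betw h' B {..<card B}"
      using less.prems(1) by (simp add: bij_betw_def eq_card_imp_inj_on)
    moreover have "h' (\<omega> x) = std_involution (Suc k) (h' x)" if "x \<in> B" for x
    proof -
      from that consider "x = b" | "x = \<omega> b" | "x \<in> C"
        by (auto simp: C_def)
      then show ?thesis
      proof cases
        case 3
        then show ?thesis
          using h(3) h'_C \<open>\<And>x. x \<in> C \<Longrightarrow> \<omega> x \<in> C\<close> std_involution_Suc(3) by simp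
      qed (use h'_b \<omega> b std_involution_Suc in auto)
    qed
    ultimately show ?thesis
      using card h(2) by (intro exI[of _ h'] exI[of _ "Suc k"]) auto
  qed
qed

section \<open>Classification of the finite unitary solutions\<close>

lemma fs_isomorphic_R_omega:
  assumes \<alpha>: "bij_betw \<alpha> A A'" and \<beta>: "bij_betw \<beta> B B'"
    and eq: "\<And>b. b \<in> B \<Longrightarrow> \<beta> (\<omega> b) = \<omega>' (\<beta> b)"
  shows "fs_isomorphic (A \<times> B) (R_omega A B \<omega>) (A' \<times> B') (R_omega A' B' \<omega>')"
  unfolding fs_isomorphic_def
proof (intro exI[of _ "map_prod \<alpha> \<beta>"] conjI ballI)
  show "bij_betw (map_prod \<alpha> \<beta>) (A \<times> B) (A' \<times> B')"
    using \<alpha> \<beta> by (rule bij_betw_map_prod)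
  have "\<alpha> a \<in> A'" if "a \<in> A" for a
    using \<alpha> that by (rule bij_betw_apply)
  moreover have "\<beta> b \<in> B'" if "b \<in> B" for b
    using \<beta> that by (rule bij_betw_apply)
  ultimately show "(map_prod (map_prod \<alpha> \<beta>) (map_prod \<alpha> \<beta>) \<circ> R_omega A B \<omega>) p =
      (R_omega A' B' \<omega>' \<circ> map_prod (map_prod \<alpha> \<beta>) (map_prod \<alpha> \<beta>)) p"
    if "p \<in> (A \<times> B) \<times> (A \<times> B)" for p
    using that by (auto simp: R_omega_apply eq)
qed

text \<open>
  Both conclusions count the solutions of an equation in the two operations. For fixed
  \<open>x = (a, b)\<close>, the first component of \<open>R_omega A B \<omega> (x, y)\<close> equals \<open>x\<close> exactly for \<open>y\<close> in
  \<open>A \<times> {b}\<close>; the second component of \<open>R_omega A B \<omega> (x, x)\<close> equals \<open>x\<close> exactly when \<open>\<omega>\<close> fixes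
  \<open>b\<close>. An isomorphism maps solutions of these equations bijectively to solutions.
\<close>

lemma R_omega_invariants:
  assumes iso: "fs_isomorphic (A \<times> B) (R_omega A B \<omega>) (A' \<times> B') (R_omega A' B' \<omega>')"
    and "A \<noteq> {}" "B \<noteq> {}" "involution_on B \<omega>"
  shows "card A = card A'"
    and "card A * card {b \<in> B. \<omega> b = b} = card A' * card {b \<in> B'. \<omega>' b = b}"
proof -
  let ?X = "A \<times> B" and ?Y = "A' \<times> B'"
  let ?R = "R_omega A B \<omega>" and ?S = "R_omega A' B' \<omega>'"
  have R: "?R p \<in> ?X \<times> ?X" if "p \<in> ?X \<times> ?X" for p
    using unitary_R_omega[OF assms(4), of A] that
    by (auto simp: unitary_fs_solution_def fs_solution_def PiE_iff)
  obtain \<sigma> where \<sigma>: "bij_betw \<sigma> ?X ?Y"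
      "\<And>p. p \<in> ?X \<times> ?X \<Longrightarrow> map_prod \<sigma> \<sigma> (?R p) = ?S (map_prod \<sigma> \<sigma> p)"
    using iso by (auto simp: fs_isomorphic_def)
  have \<sigma>_eq: "\<sigma> x = \<sigma> y \<longleftrightarrow> x = y" if "x \<in> ?X" "y \<in> ?X" for x y
    using \<sigma>(1) that by (metis bij_betw_imp_inj_on inj_onD)
  have restr: "bij_betw \<sigma> {x \<in> ?X. P x} {y \<in> ?Y. Q y}"
    if "\<And>x. x \<in> ?X \<Longrightarrow> Q (\<sigma> x) \<longleftrightarrow> P x" for P Q
    using bij_betw_Collect[OF \<sigma>(1), of Q P] that by blast
  have fst_snd: "fst (?S (\<sigma> x, \<sigma> y)) = \<sigma> (fst (?R (x, y)))"
      "snd (?S (\<sigma> x, \<sigma> y)) = \<sigma> (snd (?R (x, y)))" if "x \<in> ?X" "y \<in> ?X" for x y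
    using \<sigma>(2)[of "(x, y)"] that by (metis SigmaI fst_map_prod snd_map_prod map_prod_simp)+
  have RX: "fst (?R (x, y)) \<in> ?X" "snd (?R (x, y)) \<in> ?X" if "x \<in> ?X" "y \<in> ?X" for x y
    using R[of "(x, y)"] that by (auto simp del: mem_Sigma_iff simp: mem_Times_iff)

  obtain a b where ab: "a \<in> A" "b \<in> B"
    using assms(2,3) by blast
  then have "\<sigma> (a, b) \<in> ?Y"
    using \<sigma>(1) by (auto dest: bij_betw_apply)
  then obtain a' b' where ab': "\<sigma> (a, b) = (a', b')" "a' \<in> A'" "b' \<in> B'"
    by auto
  have "card {y \<in> ?X. fst (?R ((a, b), y)) = (a, b)} =
      card {y \<in> ?Y. fst (?S (\<sigma> (a, b), y)) = \<sigma> (a, b)}"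
    by (rule bij_betw_same_card, rule restr) (use ab in \<open>simp only: fst_snd \<sigma>_eq RX SigmaI\<close>)
  moreover have "{y \<in> ?X. fst (?R ((a, b), y)) = (a, b)} = A \<times> {b}"
    using ab by (auto simp: R_omega_apply)
  moreover have "{y \<in> ?Y. fst (?S (\<sigma> (a, b), y)) = \<sigma> (a, b)} = A' \<times> {b'}"
    using ab' by (auto simp: R_omega_apply)
  ultimately show "card A = card A'"
    by (simp add: card_cartesian_product)

  have "card {x \<in> ?X. snd (?R (x, x)) = x} = card {y \<in> ?Y. snd (?S (y, y)) = y}"
    by (rule bij_betw_same_card, rule restr) (simp only: fst_snd \<sigma>_eq RX)
  moreover have "{x \<in> ?X. snd (?R (x, x)) = x} = A \<times> {b \<in> B. \<omega> b = b}"
    by (auto simp: R_omega_apply)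
  moreover have "{y \<in> ?Y. snd (?S (y, y)) = y} = A' \<times> {b \<in> B'. \<omega>' b = b}"
    by (auto simp: R_omega_apply)
  ultimately show "card A * card {b \<in> B. \<omega> b = b} = card A' * card {b \<in> B'. \<omega>' b = b}"
    by (simp add: card_cartesian_product)
qed

abbreviation model_carrier :: "nat \<Rightarrow> nat \<Rightarrow> (nat \<times> nat) set" where
  "model_carrier n d \<equiv> {..<n div d} \<times> {..<d}"

abbreviation model :: "nat \<Rightarrow> nat \<Rightarrow> nat \<Rightarrow>
    (nat \<times> nat) \<times> (nat \<times> nat) \<Rightarrow> (nat \<times> nat) \<times> (nat \<times> nat)" where
  "model n d k \<equiv> R_omega {..<n div d} {..<d} (std_involution k)"

lemma unitary_fs_solution_iso_model:
  fixes X :: "'a set"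
  assumes "finite X" "X \<noteq> {}" "unitary_fs_solution X R"
  shows "\<exists>d k. d dvd card X \<and> 2 * k \<le> d \<and>
    fs_isomorphic X R (model_carrier (card X) d) (model (card X) d k)"
proof -
  obtain A B :: "'a set" and \<omega> where AB: "A \<noteq> {}" "B \<noteq> {}" "involution_on B \<omega>"
    and iso: "fs_isomorphic X R (A \<times> B) (R_omega A B \<omega>)"
    using unitary_fs_solution_decomposition[OF assms(2,3)] .
  obtain \<sigma> where "bij_betw \<sigma> X (A \<times> B)"
    using iso by (auto simp: fs_isomorphic_def)
  then have "finite (A \<times> B)" and card: "card X = card A * card B"
    using assms(1) by (auto simp: bij_betw_finite bij_betw_same_card card_cartesian_product
        simp flip: card_cartesian_product)
  then have fin: "finite A" "finite B"
    using AB by (auto dest: finite_cartesian_productD1 finite_cartesian_productD2)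
  have div: "card X div card B = card A"
    using card AB fin by simp
  obtain \<alpha> where \<alpha>: "bij_betw \<alpha> A {..<card A}"
    using ex_bij_betw_finite_nat[OF fin(1)] by (auto simp: atLeast0LessThan)
  obtain \<beta> k where \<beta>: "bij_betw \<beta> B {..<card B}" "2 * k \<le> card B"
      "\<And>b. b \<in> B \<Longrightarrow> \<beta> (\<omega> b) = std_involution k (\<beta> b)"
    using involution_on_normal_form[OF fin(2) AB(3)] by blast
  have "fs_isomorphic (A \<times> B) (R_omega A B \<omega>)
      (model_carrier (card X) (card B)) (model (card X) (card B) k)"
    unfolding div using \<beta>(3) by (intro fs_isomorphic_R_omega[OF \<alpha> \<beta>(1)])
  then show ?thesis
    using fs_isomorphic_trans[OF iso] card \<beta>(2) by (metis dvd_triv_right)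
qed

lemma model_iso_imp_eq:
  assumes "n > 0" "d dvd n" "2 * k \<le> d" "d' dvd n" "2 * k' \<le> d'"
    and iso: "fs_isomorphic (model_carrier n d) (model n d k) (model_carrier n d') (model n d' k')"
  shows "d = d' \<and> k = k'"
proof -
  have pos: "d > 0" "n div d > 0"
    using assms(1,2) by (auto simp: dvd_div_eq_0_iff elim!: dvdE)
  have "n div d = n div d'" "(n div d) * (d - 2 * k) = (n div d') * (d' - 2 * k')"
    using R_omega_invariants[OF iso _ _ involution_on_std[OF assms(3)]] pos
    unfolding card_fixed_points_std_involution by (simp_all add: lessThan_empty_iff)
  moreover from this(1) have "d = d'"
    using pos(2) assms(2,4) by (metis dvd_div_mult_self mult_cancel1 less_not_refl2)
  ultimately have "d - 2 * k = d - 2 * k'"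
    using pos(2) by simp
  with \<open>d = d'\<close> show ?thesis
    using assms(3,5) by linarith
qed

text \<open>
  The model lives on pairs of natural numbers; since its carrier has as many elements as \<open>X\<close>, it
  can be copied to \<open>X\<close> along a bijection.
\<close>

lemma model_realized:
  fixes X :: "'a set"
  assumes "finite X" "d dvd card X" "2 * k \<le> d"
  shows "\<exists>R. unitary_fs_solution X R \<and>
    fs_isomorphic X R (model_carrier (card X) d) (model (card X) d k)"
proof -
  let ?Y = "model_carrier (card X) d" and ?S = "model (card X) d k"
  have S: "unitary_fs_solution ?Y ?S"
    by (rule unitary_R_omega[OF involution_on_std[OF assms(3)]])
  have "card X = card ?Y"
    using assms(2) by (simp add: card_cartesian_product)
  then obtain \<sigma> where \<sigma>: "bij_betw \<sigma> X ?Y"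
    using assms(1) by (metis finite_same_card_bij finite_cartesian_product finite_lessThan)
  define \<tau> where "\<tau> = inv_into X \<sigma>"
  have \<tau>: "\<tau> y \<in> X" "\<sigma> (\<tau> y) = y" if "y \<in> ?Y" for y
    using that \<sigma>(1) unfolding \<tau>_def bij_betw_def
    by (auto simp: inv_into_into f_inv_into_f simp del: mem_Sigma_iff)
  define R where "R = restrict (map_prod \<tau> \<tau> \<circ> ?S \<circ> map_prod \<sigma> \<sigma>) (X \<times> X)"
  have S_in: "?S (map_prod \<sigma> \<sigma> p) \<in> ?Y \<times> ?Y" if "p \<in> X \<times> X" for p
  proof -
    have "map_prod \<sigma> \<sigma> p \<in> ?Y \<times> ?Y"
      using that bij_betw_apply[OF \<sigma>] by (auto simp del: mem_Sigma_iff simp: mem_Times_iff)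
    moreover have "?S \<in> ?Y \<times> ?Y \<rightarrow>\<^sub>E ?Y \<times> ?Y"
      using S by (simp only: unitary_fs_solution_def fs_solution_def)
    ultimately show ?thesis
      by (rule PiE_mem[rotated])
  qed
  have "R \<in> X \<times> X \<rightarrow>\<^sub>E X \<times> X"
    unfolding R_def using S_in \<tau>(1)
    by (intro restrict_PiE_iff[THEN iffD2] ballI)
      (simp del: mem_Sigma_iff add: mem_Times_iff)
  moreover have iso: "fs_isomorphic X R ?Y ?S"
    unfolding fs_isomorphic_def
  proof (intro exI[of _ \<sigma>] conjI ballI \<sigma>)
    fix p assume p: "p \<in> X \<times> X"
    have "map_prod \<sigma> \<sigma> (map_prod \<tau> \<tau> q) = q" if "q \<in> ?Y \<times> ?Y" for q
      using that \<tau>(2) by (cases q) (simp del: mem_Sigma_iff add: mem_Times_iff)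
    with S_in[OF p] p show "(map_prod \<sigma> \<sigma> \<circ> R) p = (?S \<circ> map_prod \<sigma> \<sigma>) p"
      by (simp add: R_def)
  qed
  ultimately show ?thesis
    using unitary_fs_solution_transport S by blast
qed

lemma equiv_unitary_fs_iso_rel:
  "equiv {R. unitary_fs_solution X R} (unitary_fs_iso_rel X)"
proof (rule equivI)
  show "unitary_fs_iso_rel X \<subseteq> {R. unitary_fs_solution X R} \<times> {R. unitary_fs_solution X R}"
    by (auto simp: unitary_fs_iso_rel_def)
  have "fs_isomorphic X R X R" for R :: "'a \<times> 'a \<Rightarrow> 'a \<times> 'a"
    unfolding fs_isomorphic_def by (rule exI[of _ id]) (auto simp: map_prod.id)
  then show "refl_on {R. unitary_fs_solution X R} (unitary_fs_iso_rel X)"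
    by (auto simp: refl_on_def unitary_fs_iso_rel_def)
  show "sym (unitary_fs_iso_rel X)"
    unfolding sym_def unitary_fs_iso_rel_def
    by (auto intro: unitary_fs_isomorphic_sym)
  show "trans (unitary_fs_iso_rel X)"
    unfolding trans_def unitary_fs_iso_rel_def by (auto intro: fs_isomorphic_trans)
qed

text \<open>
  Sending an index \<open>(d, k)\<close> to the class of a solution on \<open>X\<close> isomorphic to its model is a
  bijection: injective by \<open>model_iso_imp_eq\<close>, surjective by \<open>unitary_fs_solution_iso_model\<close>.
\<close>

lemma card_unitary_fs_iso_classes:
  fixes X :: "'a set"
  assumes "finite X" "X \<noteq> {}"
  shows "card (unitary_fs_iso_classes X) = (\<Sum>d | d dvd card X. 1 + d div 2)"
proof -
  let ?n = "card X" and ?U = "{R. unitary_fs_solution X R}" and ?E = "unitary_fs_iso_rel X"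
  have n: "?n > 0" using assms by (simp add: card_gt_0_iff)
  define P where "P = (SIGMA d:{d. d dvd ?n}. {..d div 2})"
  define r where "r = (\<lambda>(d, k). SOME R. unitary_fs_solution X R \<and>
    fs_isomorphic X R (model_carrier ?n d) (model ?n d k))"
  have r: "unitary_fs_solution X (r (d, k))"
      "fs_isomorphic X (r (d, k)) (model_carrier ?n d) (model ?n d k)" if "(d, k) \<in> P" for d k
  proof -
    have "d dvd ?n" "2 * k \<le> d" using that by (auto simp: P_def)
    from someI_ex[OF model_realized[OF assms(1) this]]
    show "unitary_fs_solution X (r (d, k))"
      "fs_isomorphic X (r (d, k)) (model_carrier ?n d) (model ?n d k)"
      by (auto simp: r_def)
  qed
  have "bij_betw (\<lambda>p. ?E `` {r p}) P (?U // ?E)"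
  proof (rule bij_betwI')
    fix p q assume "p \<in> P" "q \<in> P"
    then obtain d k d' k' where pq: "p = (d, k)" "q = (d', k')" "(d, k) \<in> P" "(d', k') \<in> P"
      by (metis surj_pair)
    show "?E `` {r p} = ?E `` {r q} \<longleftrightarrow> p = q"
    proof
      assume "?E `` {r p} = ?E `` {r q}"
      then have "fs_isomorphic X (r (d, k)) X (r (d', k'))"
        using eq_equiv_class[OF _ equiv_unitary_fs_iso_rel] r(1) pq
        by (fastforce simp: unitary_fs_iso_rel_def)
      then have "fs_isomorphic (model_carrier ?n d) (model ?n d k)
          (model_carrier ?n d') (model ?n d' k')"
        using fs_isomorphic_trans[OF fs_isomorphic_trans[OF unitary_fs_isomorphic_sym[OF r[OF pq(3)]]] r(2)[OF pq(4)]]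
        by blast
      with n have "d = d' \<and> k = k'"
        using pq by (intro model_iso_imp_eq[of ?n]) (auto simp: P_def)
      then show "p = q" using pq by simp
    qed simp
  next
    fix p assume "p \<in> P"
    then show "?E `` {r p} \<in> ?U // ?E"
      using r(1) by (cases p) (auto intro: quotientI)
  next
    fix c assume "c \<in> ?U // ?E"
    then obtain R where R: "unitary_fs_solution X R" "c = ?E `` {R}"
      by (auto elim: quotientE)
    obtain d k where dk: "d dvd ?n" "2 * k \<le> d"
        and iso: "fs_isomorphic X R (model_carrier ?n d) (model ?n d k)"
      using unitary_fs_solution_iso_model[OF assms R(1)] by blast
    then have P: "(d, k) \<in> P" by (auto simp: P_def)
    have "(R, r (d, k)) \<in> ?E"
      using R(1) r(1)[OF P] fs_isomorphic_trans[OF iso unitary_fs_isomorphic_sym[OF r[OF P]]]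
      by (auto simp: unitary_fs_iso_rel_def)
    then show "\<exists>p\<in>P. c = ?E `` {r p}"
      using equiv_class_eq[OF equiv_unitary_fs_iso_rel] P R(2) by blast
  qed
  then have "card (unitary_fs_iso_classes X) = card P"
    unfolding unitary_fs_iso_classes_def by (metis bij_betw_same_card)
  also have "\<dots> = (\<Sum>d | d dvd ?n. 1 + d div 2)"
    unfolding P_def using n by (subst card_SigmaI) auto
  finally show ?thesis .
qed

theorem corollary2p25:
  fixes X :: "'a set"
  assumes "X \<noteq> {}"
  shows
    \<comment> \<open>(1); since every decomposition of X embeds in X, the sets A and B can be taken inside 'a\<close>
    "(\<forall>R \<in> X \<times> X \<rightarrow>\<^sub>E X \<times> X.
        unitary_fs_solution X R \<longleftrightarrow>
        (\<exists>(A :: 'a set) (B :: 'a set) \<omega>. A \<noteq> {} \<and> B \<noteq> {} \<and> involution_on B \<omega> \<and>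
            fs_isomorphic X R (A \<times> B) (R_omega A B \<omega>)))
     \<and>
     \<comment> \<open>the converse half of (1) for factors A and B of arbitrary types\<close>
     (\<forall>(A :: 'b set) (B :: 'c set) \<omega>. A \<noteq> {} \<longrightarrow> B \<noteq> {} \<longrightarrow> involution_on B \<omega> \<longrightarrow>
        unitary_fs_solution (A \<times> B) (R_omega A B \<omega>) \<and>
        (\<forall>R \<in> X \<times> X \<rightarrow>\<^sub>E X \<times> X.
           fs_isomorphic X R (A \<times> B) (R_omega A B \<omega>) \<longrightarrow> unitary_fs_solution X R))
     \<and>
     \<comment> \<open>(2)\<close>
     (\<forall>n. finite X \<longrightarrow> card X = n \<longrightarrow>
        card (unitary_fs_iso_classes X) = (\<Sum>d | d dvd n. 1 + d div 2) \<and>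
        (\<Sum>d | d dvd n. 1 + d div 2) = card {d. d dvd n} + (\<Sum>d | d dvd n. d div 2))"
proof (intro conjI ballI allI impI)
  fix R assume R: "R \<in> X \<times> X \<rightarrow>\<^sub>E X \<times> X"
  show "unitary_fs_solution X R \<longleftrightarrow>
      (\<exists>(A :: 'a set) (B :: 'a set) \<omega>. A \<noteq> {} \<and> B \<noteq> {} \<and> involution_on B \<omega> \<and>
        fs_isomorphic X R (A \<times> B) (R_omega A B \<omega>))"
    using unitary_fs_solution_decomposition[OF assms]
      unitary_fs_solution_transport[OF R _ unitary_R_omega] by metis
next
  fix A :: "'b set" and B :: "'c set" and \<omega>
  assume \<omega>: "involution_on B \<omega>"
  show "unitary_fs_solution (A \<times> B) (R_omega A B \<omega>)"
    using \<omega> by (rule unitary_R_omega)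
  then show "unitary_fs_solution X R"
    if "R \<in> X \<times> X \<rightarrow>\<^sub>E X \<times> X" "fs_isomorphic X R (A \<times> B) (R_omega A B \<omega>)" for R
    using unitary_fs_solution_transport that by blast
next
  fix n assume "finite X" "card X = n"
  then show "card (unitary_fs_iso_classes X) = (\<Sum>d | d dvd n. 1 + d div 2)"
    using card_unitary_fs_iso_classes assms by blast
  show "(\<Sum>d | d dvd n. 1 + d div 2) = card {d. d dvd n} + (\<Sum>d | d dvd n. d div 2)"
    by (simp only: sum.distrib card_eq_sum)
qed

end
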